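(* Let $\alpha\in l_0(\mathbb{Z})$ be a mask satisfying $\alpha_{ev}(z)\neq 0$ for all $z\in\mathbb{T}$. Then there is a mask $\gamma\in l_1(\mathbb{Z})$ determined by $\gamma(z)=\frac{1}{\alpha_{ev}(z)}$, $z\in\mathbb{T}$, and with this $\gamma$ one has $[(\mathcal{I}-\mathcal{S}_\alpha\mathcal{D}_\gamma)c]\downarrow 2=0$ for every $c\in l_\infty(\mathbb{Z})$.
   Context: All sequences are real-valued and indexed by $\mathbb{Z}$; $l_0(\mathbb{Z})$ is the space of finitely supported sequences, $l_1(\mathbb{Z})$ and $l_\infty(\mathbb{Z})$ are the usual sequence spaces, and a mask is an element of $l_1(\mathbb{Z})$. Downsampling: $(c\downarrow 2)_k:=c_{2k}$. Convolution: $(\gamma*c)_k:=\sum_{\ell\in\mathbb{Z}}\gamma_\ell c_{k-\ell}$. The subdivision operator $\mathcal{S}_\alpha:l_\infty(\mathbb{Z})\to l_\infty(\mathbb{Z})$ is $(\mathcal{S}_\alpha c)_k:=\sum_{\ell\in\mathbb{Z}}\alpha_{k-2\ell}c_\ell$. The decimation operator is $\mathcal{D}_\gamma c:=\gamma*(c\downarrow 2)$. $\mathcal{I}$ is the identity operator. The symbol of a sequence $c$ is $c(z):=\sum_{k\in\mathbb{Z}}c_kz^k$; the even part $\alpha_{ev}$ of $\alpha$ is $(\alpha_{ev})_k:=\alpha_{2k}$, with symbol $\alpha_{ev}(z)$. $\mathbb{T}:=\{z\in\mathbb{C}:|z|=1\}$. *)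

theory Defs
  imports "HOL-Analysis.Analysis"
begin

type_synonym zseq = "int \<Rightarrow> real"

definition ell_0 :: "zseq set" where
  "ell_0 = {c. finite {k. c k \<noteq> 0}}"

definition ell_1 :: "zseq set" where
  "ell_1 = {c. (\<lambda>k. \<bar>c k\<bar>) summable_on UNIV}"

definition ell_inf :: "zseq set" where
  "ell_inf = {c. bounded (range c)}"

definition downsample2 :: "zseq \<Rightarrow> zseq" where
  "downsample2 c = (\<lambda>k. c (2 * k))"

definition even_part :: "zseq \<Rightarrow> zseq" where
  "even_part \<alpha> = (\<lambda>k. \<alpha> (2 * k))"

(* infsum is 0 when the family is not summable.  Below, conv and decimation are only
   meaningful for \<gamma> in ell_1, subdivision for \<alpha> in ell_1 (both applied to sequences in ell_inf),
   and the symbol for c in ell_1 with |z| = 1; in these cases all sums converge absolutely. *)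
definition conv :: "zseq \<Rightarrow> zseq \<Rightarrow> zseq" where
  "conv \<gamma> c = (\<lambda>k. \<Sum>\<^sub>\<infinity>l. \<gamma> l * c (k - l))"

definition subdivision :: "zseq \<Rightarrow> zseq \<Rightarrow> zseq" where
  "subdivision \<alpha> c = (\<lambda>k. \<Sum>\<^sub>\<infinity>l. \<alpha> (k - 2 * l) * c l)"

definition decimation :: "zseq \<Rightarrow> zseq \<Rightarrow> zseq" where
  "decimation \<gamma> c = conv \<gamma> (downsample2 c)"

definition symbol :: "zseq \<Rightarrow> complex \<Rightarrow> complex" where
  "symbol c z = (\<Sum>\<^sub>\<infinity>k. complex_of_real (c k) * z powi k)"

definition unit_circle :: "complex set" where
  "unit_circle = {z. norm z = 1}"

end

theory Submission
  imports Defs "HOL-Computational_Algebra.Fundamental_Theorem_Algebra"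
begin

text \<open>
  Only even positions matter in the conclusion. Writing \<open>b\<close> for the even part of \<open>\<alpha>\<close>, the
  sequence \<open>S\<^sub>\<alpha> e\<close> restricted to even positions is the convolution \<open>b * e\<close>
  (\<open>subdivision_even\<close>), so with \<open>e = \<gamma> * (c \<down> 2)\<close> the claim becomes
  \<open>b * (\<gamma> * (c \<down> 2)) = c \<down> 2\<close>. As \<open>b\<close> has finite support, the convolutions may be
  reassociated, and everything reduces to \<open>b * \<gamma> = \<delta>\<close> (\<open>convolution_inverse\<close>). The two sides
  of this equation have the same symbol on the unit circle, and a summable sequence is
  determined by its symbol.

  That last fact also gives the uniqueness of \<open>\<gamma>\<close>. It is shown by averaging over roots of
  unity instead of integrating: the mean of \<open>\<omega>\<^sup>-\<^sup>j g(\<omega>)\<close> over the \<open>N\<close>-th roots of unity \<open>\<omega>\<close>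
  keeps the coefficient \<open>g\<^sub>j\<close>, annihilates those at distance less than \<open>N\<close> from \<open>j\<close>, and
  leaves a remainder bounded by a tail of the absolutely convergent series.

  The existence of \<open>\<gamma>\<close> is the Wiener lemma, but for a Laurent polynomial it is elementary.
  Functions on the circle with an absolutely convergent Fourier series are closed under
  products (\<open>abs_fourier_mult\<close>), and \<open>1 / (z - r)\<close> is such a function whenever \<open>|r| \<noteq> 1\<close>, by a
  geometric series in \<open>r / z\<close> or \<open>z / r\<close>. Since the Laurent polynomial does not vanish on the
  circle, factoring it over the complex numbers shows that its reciprocal is such a function
  too. The reciprocal commutes with complex conjugation because \<open>b\<close> is real, so the real parts
  of its coefficients serve as \<open>\<gamma>\<close> (\<open>abs_fourier_real_symbol\<close>).
\<close>

section \<open>Infinite sums\<close>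

lemma has_sum_sum:
  fixes f :: "'i \<Rightarrow> 'a \<Rightarrow> 'b::topological_comm_monoid_add"
  assumes "finite I" "\<And>i. i \<in> I \<Longrightarrow> (f i has_sum S i) A"
  shows "((\<lambda>x. \<Sum>i\<in>I. f i x) has_sum (\<Sum>i\<in>I. S i)) A"
  using assms by (induction I rule: finite_induct) (auto intro!: has_sum_add)

text \<open>
  The product family is summable because a summable family of complex numbers is absolutely
  summable.
\<close>

lemma has_sum_product_complex:
  fixes f :: "'a \<Rightarrow> complex" and g :: "'b \<Rightarrow> complex"
  assumes f: "(f has_sum S) A" and g: "(g has_sum T) B"
  shows "((\<lambda>(x, y). f x * g y) has_sum S * T) (A \<times> B)"
proof (rule has_sum_SigmaI)
  show "((\<lambda>y. case (x, y) of (x, y) \<Rightarrow> f x * g y) has_sum f x * T) B" for x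
    using has_sum_cmult_right[OF g, of "f x"] by simp
  show "((\<lambda>x. f x * T) has_sum S * T) A"
    by (rule has_sum_cmult_left[OF f])
  have f': "(\<lambda>x. norm (f x)) summable_on A" and g': "(\<lambda>y. norm (g y)) summable_on B"
    using f g summable_on_iff_abs_summable_on_complex has_sum_imp_summable by blast+
  have "(\<lambda>p. norm (case p of (x, y) \<Rightarrow> f x * g y)) summable_on A \<times> B"
    unfolding Infinite_Sum.abs_summable_on_Sigma_iff
    using f' g' by (auto simp: norm_mult infsum_cmult_right' abs_mult
        intro!: summable_on_cmult_right summable_on_cmult_left)
  then show "(\<lambda>(x, y). f x * g y) summable_on A \<times> B"
    using summable_on_iff_abs_summable_on_complex by blast
qed

section \<open>Absolutely convergent Fourier series\<close>

text \<open>
  Absolute convergence is implicit: \<open>has_sum\<close> over the complex numbers already forces \<open>g\<close> to be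
  absolutely summable (take \<open>z = 1\<close>).
\<close>

definition abs_fourier :: "(complex \<Rightarrow> complex) \<Rightarrow> bool" where
  "abs_fourier f \<longleftrightarrow> (\<exists>g::int \<Rightarrow> complex.
     \<forall>z. norm z = 1 \<longrightarrow> ((\<lambda>k. g k * z powi k) has_sum f z) UNIV)"

lemma norm_powi_unit: "norm z = 1 \<Longrightarrow> norm (z powi k) = (1::real)"
  for z :: complex
  by (simp add: norm_power_int)

text \<open>
  The exponents of an absolutely convergent family of monomials may repeat, since the
  coefficients of equal exponents can be summed first. Products and geometric series are then
  handled with their natural index sets.
\<close>

lemma abs_fourierI_family:
  fixes x :: "'i \<Rightarrow> complex" and e :: "'i \<Rightarrow> int"
  assumes "\<And>z. norm z = 1 \<Longrightarrow> ((\<lambda>i. x i * z powi e i) has_sum f z) I"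
  shows "abs_fourier f"
  unfolding abs_fourier_def
proof (intro exI allI impI)
  fix z :: complex assume z: "norm z = 1"
  have x: "x summable_on I"
    using assms[of 1] by (auto simp: has_sum_imp_summable)
  have "bij_betw (\<lambda>i. (e i, i)) I (SIGMA k:UNIV. {i \<in> I. e i = k})"
    by (rule bij_betwI[where g = snd]) auto
  from has_sum_reindex_bij_betw[OF this, of "\<lambda>(k, i). x i * z powi k" "f z"]
  have "((\<lambda>(k, i). x i * z powi k) has_sum f z) (SIGMA k:UNIV. {i \<in> I. e i = k})"
    using assms[OF z] by simp
  then show "((\<lambda>k. infsum x {i \<in> I. e i = k} * z powi k) has_sum f z) UNIV"
  proof (rule has_sum_Sigma')
    fix k :: int
    have "(x has_sum infsum x {i \<in> I. e i = k}) {i \<in> I. e i = k}"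
      by (rule has_sum_infsum, rule summable_on_subset_banach[OF x]) auto
    from has_sum_cmult_left[OF this, of "z powi k"]
    show "((\<lambda>i. case (k, i) of (k, i) \<Rightarrow> x i * z powi k) has_sum
        infsum x {i \<in> I. e i = k} * z powi k) {i \<in> I. e i = k}" by simp
  qed
qed

lemma abs_fourier_cong:
  assumes "abs_fourier f" "\<And>z. norm z = 1 \<Longrightarrow> f z = g z"
  shows "abs_fourier g"
  using assms unfolding abs_fourier_def by auto

lemma abs_fourier_monom: "abs_fourier (\<lambda>z. c * z powi m)"
  by (rule abs_fourierI_family[where I = "{()}" and x = "\<lambda>_. c" and e = "\<lambda>_. m"])
    (simp add: has_sum_finite_iff)

lemma abs_fourier_mult:
  assumes "abs_fourier f" "abs_fourier g"
  shows "abs_fourier (\<lambda>z. f z * g z)"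
proof -
  obtain a b :: "int \<Rightarrow> complex" where
    a: "\<And>z. norm z = 1 \<Longrightarrow> ((\<lambda>k. a k * z powi k) has_sum f z) UNIV" and
    b: "\<And>z. norm z = 1 \<Longrightarrow> ((\<lambda>k. b k * z powi k) has_sum g z) UNIV"
    using assms unfolding abs_fourier_def by blast
  show ?thesis
  proof (rule abs_fourierI_family[where I = "UNIV \<times> UNIV" and x = "\<lambda>(k, l). a k * b l"
        and e = "\<lambda>(k, l). k + l"])
    fix z :: complex assume z: "norm z = 1"
    then have "z \<noteq> 0" by auto
    then show "((\<lambda>i. (case i of (k, l) \<Rightarrow> a k * b l) * z powi (case i of (k, l) \<Rightarrow> k + l))
        has_sum f z * g z) (UNIV \<times> UNIV)"
      using has_sum_product_complex[OF a[OF z] b[OF z]]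
      by (simp add: case_prod_unfold power_int_add mult_ac)
  qed
qed

lemma has_sum_geometric:
  fixes w :: complex
  assumes "norm w < 1"
  shows "((\<lambda>n. w ^ n) has_sum 1 / (1 - w)) (UNIV::nat set)"
  using assms geometric_sums[of w] summable_geometric[of "norm w"]
  by (intro norm_summable_imp_has_sum) (auto simp: norm_power)

text \<open>
  Expand \<open>1 / (z - r)\<close> in powers of \<open>r / z\<close> if \<open>r\<close> lies inside the circle, and in powers of
  \<open>z / r\<close> if it lies outside.
\<close>

lemma abs_fourier_inverse_linear:
  assumes "norm r \<noteq> 1"
  shows "abs_fourier (\<lambda>z. 1 / (z - r))"
proof (cases "norm r < 1")
  case True
  show ?thesis
  proof (rule abs_fourierI_family[where I = "UNIV :: nat set" and x = "\<lambda>n. r ^ n"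
        and e = "\<lambda>n. - 1 - int n"])
    fix z :: complex assume z: "norm z = 1"
    then have z0: "z \<noteq> 0" by auto
    have "norm (r / z) < 1" using True z by (simp add: norm_divide)
    from has_sum_cmult_left[OF has_sum_geometric[OF this], of "inverse z"]
    moreover have "1 / (1 - r / z) * inverse z = 1 / (z - r)"
      using z0 assms z by (auto simp: divide_simps)
    moreover have "(r / z) ^ n * inverse z = r ^ n * z powi (- 1 - int n)" for n
      using z0 by (simp add: power_int_diff power_int_minus field_simps)
    ultimately show "((\<lambda>n. r ^ n * z powi (- 1 - int n)) has_sum 1 / (z - r)) UNIV"
      by simp
  qed
next
  case False
  with assms have r: "norm r > 1" by simp
  then have r0: "r \<noteq> 0" by auto
  show ?thesis
  proof (rule abs_fourierI_family[where I = "UNIV :: nat set"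
        and x = "\<lambda>n. - inverse r * inverse r ^ n" and e = "\<lambda>n. int n"])
    fix z :: complex assume z: "norm z = 1"
    then have "r \<noteq> z" using assms by auto
    have "norm (z / r) < 1" using r r0 z by (simp add: norm_divide divide_simps)
    from has_sum_cmult_right[OF has_sum_geometric[OF this], of "- inverse r"]
    moreover have "- inverse r * (1 / (1 - z / r)) = 1 / (z - r)"
      using r0 \<open>r \<noteq> z\<close> by (simp add: divide_simps)
    ultimately show "((\<lambda>n. - inverse r * inverse r ^ n * z powi int n) has_sum 1 / (z - r)) UNIV"
      by (simp add: divide_inverse power_mult_distrib mult_ac)
  qed
qed

text \<open>
  Split off one linear factor at a time; no root of \<open>p\<close> lies on the circle.
\<close>

lemma abs_fourier_inverse_poly:
  fixes p :: "complex poly"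
  assumes "\<And>z. norm z = 1 \<Longrightarrow> poly p z \<noteq> 0"
  shows "abs_fourier (\<lambda>z. 1 / poly p z)"
  using assms
proof (induction "degree p" arbitrary: p)
  case 0
  then obtain c where "p = [:c:]" by (metis degree_eq_zeroE)
  then show ?case using abs_fourier_monom[of "1 / c" 0] by simp
next
  case (Suc n)
  then have "\<not> constant (poly p)" by (simp add: constant_degree)
  then obtain r where "poly p r = 0" using fundamental_theorem_of_algebra by blast
  then obtain q where p: "p = [:- r, 1:] * q" by (auto simp: poly_eq_0_iff_dvd)
  have "p \<noteq> 0" using Suc.hyps by auto
  then have "degree q = n" using Suc.hyps(2) p by (subst (asm) p, subst (asm) degree_mult_eq) auto
  moreover have "norm r \<noteq> 1" and "\<And>z. norm z = 1 \<Longrightarrow> poly q z \<noteq> 0"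
    using Suc.prems \<open>poly p r = 0\<close> by (auto simp: p)
  ultimately have "abs_fourier (\<lambda>z. 1 / (z - r) * (1 / poly q z))"
    using Suc.hyps(1) by (intro abs_fourier_mult abs_fourier_inverse_linear) auto
  then show ?case by (rule abs_fourier_cong) (simp add: p algebra_simps)
qed

lemma abs_fourier_inverse_laurent_poly:
  fixes a :: "int \<Rightarrow> complex"
  assumes "finite F" and nz: "\<And>z. norm z = 1 \<Longrightarrow> (\<Sum>k\<in>F. a k * z powi k) \<noteq> 0"
  shows "abs_fourier (\<lambda>z. 1 / (\<Sum>k\<in>F. a k * z powi k))"
proof -
  \<comment> \<open>Pulling out the power \<open>z powi m\<close>, with \<open>m\<close> a lower bound of the exponents, leaves a genuine
     polynomial.\<close>
  obtain m where m: "\<And>k. k \<in> F \<Longrightarrow> k \<ge> m"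
    using \<open>finite F\<close> by (meson Min_le)
  define p where "p = (\<Sum>k\<in>F. Polynomial.monom (a k) (nat (k - m)))"
  have p: "(\<Sum>k\<in>F. a k * z powi k) = z powi m * poly p z" if "norm z = 1" for z
  proof -
    have "z \<noteq> 0" using that by auto
    have "z powi k = z powi m * z ^ nat (k - m)" if "k \<in> F" for k
      using m[OF that] \<open>z \<noteq> 0\<close> by (simp flip: power_int_nonneg_exp power_int_add)
    then show ?thesis
      by (simp add: p_def poly_sum poly_monom sum_distrib_left mult_ac)
  qed
  have "poly p z \<noteq> 0" if "norm z = 1" for z
    using nz[OF that] unfolding p[OF that] by simp
  then have "abs_fourier (\<lambda>z. 1 * z powi (- m) * (1 / poly p z))"
    by (intro abs_fourier_mult abs_fourier_monom abs_fourier_inverse_poly)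
  then show ?thesis
    by (rule abs_fourier_cong) (simp add: p power_int_minus_divide)
qed

section \<open>Uniqueness of the coefficients\<close>

text \<open>
  With \<open>u\<close> the \<open>d\<close>-th power of a primitive \<open>N\<close>-th root of unity, this is the geometric sum of
  \<open>u ^ n\<close>; it vanishes as \<open>u ^ N = 1\<close>, while \<open>u \<noteq> 1\<close> because \<open>N\<close> does not divide \<open>d\<close>.
\<close>

lemma average_root_of_unity_powers:
  fixes N :: nat and d :: int
  assumes "\<bar>d\<bar> < int N" "d \<noteq> 0"
  shows "(\<Sum>n<N. (cis (2 * pi / real N) ^ n) powi d) = 0"
proof -
  define u where "u = cis (2 * pi / real N) powi d"
  have N: "N > 0" using assms by auto
  have "u = cis (real_of_int d * (2 * pi / real N))"
    by (simp add: u_def cis_power_int)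
  moreover have "cis (real_of_int d * (2 * pi / real N)) \<noteq> 1"
  proof
    assume "cis (real_of_int d * (2 * pi / real N)) = 1"
    then have "exp (\<i> * of_real (real_of_int d * (2 * pi / real N))) = 1"
      by (simp add: cis_conv_exp)
    then obtain n :: int where "real_of_int d * (2 * pi / real N) = of_int (2 * n) * pi"
      unfolding exp_eq_1 by auto
    then have "real_of_int d = of_int (n * int N)"
      using N by (simp add: field_simps)
    then have "d = n * int N" by (simp only: of_int_eq_iff)
    with assms show False
      by (metis dvd_triv_right zdvd_not_zless dvd_abs_iff zero_less_abs_iff)
  qed
  ultimately have "u \<noteq> 1" by simp
  have "u ^ N = 1"
  proof -
    have "u ^ N = (cis (2 * pi / real N) ^ N) powi d"
      by (simp add: u_def power_int_power power_int_power' mult.commute)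
    also have "cis (2 * pi / real N) ^ N = cis (2 * pi)" using N unfolding Complex.DeMoivre by simp
    finally show ?thesis by (simp add: complex_eq_iff)
  qed
  have "(\<Sum>n<N. (cis (2 * pi / real N) ^ n) powi d) = (\<Sum>n<N. u ^ n)"
    by (simp add: u_def power_int_power power_int_power' mult.commute)
  also have "\<dots> = 0" using \<open>u \<noteq> 1\<close> \<open>u ^ N = 1\<close> by (simp add: sum_gp_strict)
  finally show ?thesis .
qed

text \<open>
  Averaging \<open>w powi (- j)\<close> times the series over the \<open>N\<close>-th roots of unity \<open>w\<close> multiplies the \<open>k\<close>-th
  coefficient by a factor \<open>avg k\<close> of modulus at most \<open>1\<close>, with \<open>avg j = 1\<close> and \<open>avg k = 0\<close> for all
  other \<open>k\<close> within distance less than \<open>N\<close> of \<open>j\<close>. Hence \<open>g j\<close> is bounded by a tail of the series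
  of \<open>norm (g k)\<close>, which is arbitrarily small for large \<open>N\<close>.
\<close>

lemma fourier_coefficients_eq_zero:
  fixes g :: "int \<Rightarrow> complex"
  assumes g: "\<And>z. norm z = 1 \<Longrightarrow> ((\<lambda>k. g k * z powi k) has_sum 0) UNIV"
  shows "g j = 0"
proof -
  have abs: "(\<lambda>k. norm (g k)) summable_on UNIV"
    using has_sum_imp_summable[OF g[of 1]] summable_on_iff_abs_summable_on_complex[of g UNIV] by simp
  have "norm (g j) \<le> \<epsilon>" if "\<epsilon> > 0" for \<epsilon>
  proof -
    obtain F0 where F0: "finite F0" "dist (\<Sum>k\<in>F0. norm (g k)) (\<Sum>\<^sub>\<infinity>k. norm (g k)) \<le> \<epsilon>"
      using infsum_finite_approximation[OF abs \<open>\<epsilon> > 0\<close>] by auto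
    define F where "F = insert j F0"
    have F: "finite F" "j \<in> F" using F0 by (auto simp: F_def)
    have tail: "infsum (\<lambda>k. norm (g k)) (- F) \<le> \<epsilon>"
    proof -
      have "infsum (\<lambda>k. norm (g k)) (- F) = (\<Sum>\<^sub>\<infinity>k. norm (g k)) - (\<Sum>k\<in>F. norm (g k))"
        using infsum_Diff[OF abs, of F] F by (simp add: Compl_eq_Diff_UNIV)
      moreover have "(\<Sum>k\<in>F0. norm (g k)) \<le> (\<Sum>k\<in>F. norm (g k))"
        using F by (intro sum_mono2) (auto simp: F_def)
      ultimately show ?thesis using F0(2) by (simp add: dist_real_def abs_le_iff)
    qed
    \<comment> \<open>Any \<open>N\<close> exceeding the distance from \<open>j\<close> to every element of \<open>F\<close> would do.\<close>
    define N where "N = Suc (\<Sum>k\<in>F. nat \<bar>k - j\<bar>)"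
    have N: "\<bar>k - j\<bar> < int N" if "k \<in> F" for k
      using member_le_sum[OF that, of "\<lambda>k. nat \<bar>k - j\<bar>"] F
      unfolding N_def by linarith
    have N0: "N > 0" by (simp add: N_def)
    define w where "w = cis (2 * pi / real N)"
    have w: "norm (w ^ n) = 1" for n by (simp add: w_def norm_power)
    define avg where "avg k = (\<Sum>n<N. (w ^ n) powi (k - j)) / of_nat N" for k
    have avg_j: "avg j = 1" using N0 by (simp add: avg_def)
    have avg_F: "avg k = 0" if "k \<in> F" "k \<noteq> j" for k
      using average_root_of_unity_powers[OF N[OF that(1)]] that(2) by (simp add: avg_def w_def)
    have avg_le: "norm (avg k) \<le> 1" for k
    proof -
      have "norm (\<Sum>n<N. (w ^ n) powi (k - j)) \<le> (\<Sum>n<N. 1)"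
        by (rule sum_norm_le) (simp add: norm_powi_unit w)
      then show ?thesis using N0 by (simp add: avg_def norm_divide)
    qed
    have "((\<lambda>k. \<Sum>n<N. g k * (w ^ n) powi k * (w ^ n) powi (- j)) has_sum
        (\<Sum>n<N. 0 * (w ^ n) powi (- j))) UNIV"
      by (intro has_sum_sum has_sum_cmult_left g w) auto
    moreover have "(\<Sum>n<N. g k * (w ^ n) powi k * (w ^ n) powi (- j)) = of_nat N * (avg k * g k)" for k
    proof -
      have "(w ^ n) powi (k - j) = (w ^ n) powi k * (w ^ n) powi (- j)" for n
        using power_int_add[of "w ^ n" k "- j"] w[of n] by fastforce
      then show ?thesis
        using N0 by (simp add: avg_def mult_ac flip: sum_distrib_left)
    qed
    ultimately have "((\<lambda>k. of_nat N * (avg k * g k)) has_sum 0) UNIV" by simp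
    then have "((\<lambda>k. avg k * g k) has_sum 0) UNIV"
      using N0 by (subst (asm) has_sum_cmult_right_iff) auto
    from has_sum_Diff[OF this has_sum_finite[OF F(1)]]
    have "((\<lambda>k. avg k * g k) has_sum - (\<Sum>k\<in>F. avg k * g k)) (- F)"
      by (simp add: Compl_eq_Diff_UNIV)
    moreover have "(\<Sum>k\<in>F. avg k * g k) = (\<Sum>k\<in>F. if k = j then g j else 0)"
      by (intro sum.cong) (auto simp: avg_j avg_F)
    ultimately have "((\<lambda>k. avg k * g k) has_sum - g j) (- F)" using F by simp
    moreover have "((\<lambda>k. norm (g k)) has_sum infsum (\<lambda>k. norm (g k)) (- F)) (- F)"
      by (rule has_sum_infsum, rule summable_on_subset_banach[OF abs]) auto
    ultimately have "norm (- g j) \<le> infsum (\<lambda>k. norm (g k)) (- F)"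
      by (rule norm_infsum_le) (use avg_le in \<open>auto simp: norm_mult intro: mult_left_le_one_le\<close>)
    with tail show ?thesis by simp
  qed
  then show ?thesis
    using field_le_epsilon[of "norm (g j)" 0] by simp
qed

section \<open>Symbols of real sequences\<close>

lemma ell_1_iff: "c \<in> ell_1 \<longleftrightarrow> c summable_on UNIV"
  using summable_on_iff_abs_summable_on_real[of c UNIV] by (simp add: ell_1_def)

lemma has_sum_symbol:
  assumes "c \<in> ell_1" "norm z = 1"
  shows "((\<lambda>k. complex_of_real (c k) * z powi k) has_sum symbol c z) UNIV"
  unfolding symbol_def
proof (rule has_sum_infsum, rule abs_summable_summable)
  show "(\<lambda>k. norm (complex_of_real (c k) * z powi k)) summable_on UNIV"
    using assms by (simp add: norm_mult norm_powi_unit ell_1_def)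
qed

lemma symbol_unique:
  assumes "c \<in> ell_1" "d \<in> ell_1" "\<And>z. norm z = 1 \<Longrightarrow> symbol c z = symbol d z"
  shows "c = d"
proof
  fix j
  have "complex_of_real (c j) - complex_of_real (d j) = 0"
  proof (rule fourier_coefficients_eq_zero)
    fix z :: complex assume z: "norm z = 1"
    have "((\<lambda>k. complex_of_real (c k) * z powi k + (- 1) * (complex_of_real (d k) * z powi k))
        has_sum symbol c z + (- 1) * symbol d z) UNIV"
      by (intro has_sum_add has_sum_cmult_right has_sum_symbol assms z)
    then show "((\<lambda>k. (complex_of_real (c k) - complex_of_real (d k)) * z powi k) has_sum 0) UNIV"
      using assms(3)[OF z] by (simp add: algebra_simps)
  qed
  then show "c j = d j" by simp
qed

lemma symbol_cnj: "symbol c (cnj z) = cnj (symbol c z)"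
  by (simp add: symbol_def flip: infsum_cnj)

text \<open>
  If \<open>g\<close> is a coefficient sequence of \<open>f\<close>, the symmetry of \<open>f\<close> makes the conjugate sequence
  another one, and the average of the two is the sequence of real parts.
\<close>

lemma abs_fourier_real_symbol:
  assumes "abs_fourier f" "\<And>z. norm z = 1 \<Longrightarrow> f (cnj z) = cnj (f z)"
  shows "\<exists>c\<in>ell_1. \<forall>z. norm z = 1 \<longrightarrow> symbol c z = f z"
proof -
  obtain g :: "int \<Rightarrow> complex"
    where g: "\<And>z. norm z = 1 \<Longrightarrow> ((\<lambda>k. g k * z powi k) has_sum f z) UNIV"
    using assms(1) unfolding abs_fourier_def by blast
  have "(\<lambda>k. Re (g k)) summable_on UNIV"
    using has_sum_imp_summable[OF g[of 1]] by (intro summable_on_Re) simp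
  then have 1: "(\<lambda>k. Re (g k)) \<in> ell_1"
    by (simp add: ell_1_iff)
  have "symbol (\<lambda>k. Re (g k)) z = f z" if z: "norm z = 1" for z
  proof -
    have "((\<lambda>k. cnj (g k * cnj z powi k)) has_sum cnj (f (cnj z))) UNIV"
      using g[of "cnj z"] z by (subst has_sum_cnj_iff) simp
    then have "((\<lambda>k. cnj (g k) * z powi k) has_sum f z) UNIV"
      using assms(2)[OF z] by simp
    from has_sum_cmult_left[OF has_sum_add[OF g[OF z] this], of "1/2"]
    have "((\<lambda>k. complex_of_real (Re (g k)) * z powi k) has_sum f z) UNIV"
      by (simp add: complex_add_cnj flip: distrib_right)
    then show ?thesis unfolding symbol_def by (rule infsumI)
  qed
  with 1 show ?thesis by blast
qed

section \<open>Convolution inverses of finitely supported masks\<close>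

lemma bij_int_shift: "bij (\<lambda>k::int. k - m)"
  by (rule bij_betwI[where g = "\<lambda>k. k + m"]) auto

text \<open>
  Both sides are summable sequences in \<open>j\<close>, and the symbol of each is \<open>1\<close> on the unit circle.
\<close>

lemma convolution_inverse:
  assumes F: "finite F" "{k. b k \<noteq> 0} \<subseteq> F" and \<gamma>: "\<gamma> \<in> ell_1"
    and inv: "\<And>z. norm z = 1 \<Longrightarrow> symbol \<gamma> z * (\<Sum>k\<in>F. complex_of_real (b k) * z powi k) = 1"
  shows "(\<Sum>m\<in>F. b m * \<gamma> (j - m)) = (if j = 0 then 1 else 0)"
proof -
  define h :: zseq where "h j = (\<Sum>m\<in>F. b m * \<gamma> (j - m))" for j
  define \<delta> :: zseq where "\<delta> j = (if j = 0 then 1 else 0)" for j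
  have shift: "(\<lambda>j. \<gamma> (j - m)) summable_on UNIV" for m
    using \<gamma> summable_on_reindex_bij_betw[OF bij_int_shift, of \<gamma> m] by (simp add: ell_1_iff)
  have "(h has_sum (\<Sum>m\<in>F. b m * infsum (\<lambda>j. \<gamma> (j - m)) UNIV)) UNIV"
    unfolding h_def by (intro has_sum_sum has_sum_cmult_right has_sum_infsum shift F)
  then have h: "h \<in> ell_1" by (auto simp: ell_1_iff has_sum_imp_summable)
  have \<delta>: "\<delta> \<in> ell_1" unfolding ell_1_iff
    by (rule finite_nonzero_values_imp_summable_on) (simp add: \<delta>_def)
  have "symbol h z = symbol \<delta> z" if z: "norm z = 1" for z
  proof -
    have z0: "z \<noteq> 0" using z by auto
    \<comment> \<open>Shifting a sequence by \<open>m\<close> multiplies its symbol by \<open>z powi m\<close>.\<close>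
    have "((\<lambda>j. complex_of_real (b m) * z powi m * (complex_of_real (\<gamma> (j - m)) * z powi (j - m)))
        has_sum complex_of_real (b m) * z powi m * symbol \<gamma> z) UNIV" for m
      using has_sum_reindex_bij_betw[OF bij_int_shift[of m],
          of "\<lambda>j. complex_of_real (\<gamma> j) * z powi j"] has_sum_symbol[OF \<gamma> z]
      by (intro has_sum_cmult_right) simp
    moreover have "complex_of_real (b m) * z powi m * (complex_of_real (\<gamma> (j - m)) * z powi (j - m))
        = complex_of_real (b m * \<gamma> (j - m)) * z powi j" for m j
      using z0 power_int_add[of z m "j - m"] by simp
    ultimately have "((\<lambda>j. complex_of_real (b m * \<gamma> (j - m)) * z powi j)
        has_sum complex_of_real (b m) * z powi m * symbol \<gamma> z) UNIV" for m
      by simp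
    then have "((\<lambda>j. \<Sum>m\<in>F. complex_of_real (b m * \<gamma> (j - m)) * z powi j)
        has_sum (\<Sum>m\<in>F. complex_of_real (b m) * z powi m * symbol \<gamma> z)) UNIV"
      by (intro has_sum_sum F)
    then have "((\<lambda>j. complex_of_real (h j) * z powi j) has_sum 1) UNIV"
      using inv[OF z] by (simp add: h_def sum_distrib_left sum_distrib_right mult_ac)
    then have "symbol h z = 1"
      unfolding symbol_def by (rule infsumI)
    moreover have "((\<lambda>j. complex_of_real (\<delta> j) * z powi j) has_sum 1) UNIV"
      by (rule has_sum_finite_neutralI[of "{0}"]) (auto simp: \<delta>_def)
    then have "symbol \<delta> z = 1"
      unfolding symbol_def by (rule infsumI)
    ultimately show ?thesis by simp
  qed
  then have "h = \<delta>" by (rule symbol_unique[OF h \<delta>])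
  then show ?thesis by (simp add: fun_eq_iff h_def \<delta>_def)
qed

lemma ell_1_mult_ell_inf_summable:
  assumes "\<gamma> \<in> ell_1" "d \<in> ell_inf"
  shows "(\<lambda>l. \<gamma> l * d (k - l)) summable_on UNIV"
proof -
  obtain B where B: "\<And>k. \<bar>d k\<bar> \<le> B"
    using assms(2) by (auto simp: ell_inf_def bounded_iff)
  have "(\<lambda>l. \<bar>\<gamma> l\<bar> * B) summable_on UNIV"
    using assms(1) by (auto simp: ell_1_def intro: summable_on_cmult_left)
  then have "(\<lambda>l. norm (\<gamma> l * d (k - l))) summable_on UNIV"
    by (rule Infinite_Sum.abs_summable_on_comparison_test') (simp add: abs_mult B mult_left_mono)
  then show ?thesis by (rule abs_summable_summable)
qed

text \<open>
  At an even position \<open>2 * k\<close> only the entries \<open>\<alpha> (2 * (k - l))\<close> occur in the subdivision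
  operator; substituting \<open>m = k - l\<close> gives a convolution with the even part.
\<close>

lemma subdivision_even:
  assumes "finite F" "{k. even_part \<alpha> k \<noteq> 0} \<subseteq> F"
  shows "subdivision \<alpha> e (2 * k) = (\<Sum>m\<in>F. even_part \<alpha> m * e (k - m))"
proof -
  have "subdivision \<alpha> e (2 * k) = (\<Sum>\<^sub>\<infinity>m. even_part \<alpha> m * e (k - m))"
    unfolding subdivision_def
    by (rule infsum_reindex_bij_witness[of _ "\<lambda>m. k - m" "\<lambda>l. k - l"])
      (auto simp: even_part_def right_diff_distrib)
  also have "\<dots> = (\<Sum>m\<in>F. even_part \<alpha> m * e (k - m))"
    by (rule infsumI, rule has_sum_finite_neutralI) (use assms in auto)
  finally show ?thesis .
qed

text \<open>
  This is \<open>b * (\<gamma> * d) = (b * \<gamma>) * d = d\<close>. The reassociation only exchanges a finite sum with an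
  infinite one.
\<close>

lemma convolution_inverse_conv:
  assumes F: "finite F" and \<gamma>: "\<gamma> \<in> ell_1" and d: "d \<in> ell_inf"
    and inv: "\<And>j. (\<Sum>m\<in>F. b m * \<gamma> (j - m)) = (if j = 0 then 1 else 0)"
  shows "(\<Sum>m\<in>F. b m * conv \<gamma> d (k - m)) = d k"
proof -
  have "((\<lambda>j. \<gamma> (j - m) * d (k - j)) has_sum conv \<gamma> d (k - m)) UNIV" for m
  proof -
    have "((\<lambda>l. \<gamma> l * d (k - m - l)) has_sum conv \<gamma> d (k - m)) UNIV"
      unfolding conv_def by (intro has_sum_infsum ell_1_mult_ell_inf_summable \<gamma> d)
    then show ?thesis
      by (subst (asm) has_sum_reindex_bij_betw[OF bij_int_shift[of m], symmetric]) simp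
  qed
  then have "((\<lambda>j. \<Sum>m\<in>F. b m * (\<gamma> (j - m) * d (k - j))) has_sum
      (\<Sum>m\<in>F. b m * conv \<gamma> d (k - m))) UNIV"
    by (intro has_sum_sum has_sum_cmult_right F)
  moreover have "(\<Sum>m\<in>F. b m * (\<gamma> (j - m) * d (k - j))) = (if j = 0 then d k else 0)" for j
    using inv[of j] by (simp add: sum_distrib_right[symmetric] mult.assoc[symmetric])
  moreover have "((\<lambda>j::int. if j = 0 then d k else 0) has_sum d k) UNIV"
    by (rule has_sum_finite_neutralI[of "{0}"]) auto
  ultimately show ?thesis using has_sum_unique by auto
qed

section \<open>Exact recovery at even positions\<close>

theorem corollary5:
  fixes \<alpha> :: zseq
  assumes "\<alpha> \<in> ell_0"
    and "\<forall>z\<in>unit_circle. symbol (even_part \<alpha>) z \<noteq> 0"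
  shows "(\<exists>!\<gamma>. \<gamma> \<in> ell_1 \<and> (\<forall>z\<in>unit_circle. symbol \<gamma> z = 1 / symbol (even_part \<alpha>) z)) \<and>
    (\<forall>\<gamma>. \<gamma> \<in> ell_1 \<and> (\<forall>z\<in>unit_circle. symbol \<gamma> z = 1 / symbol (even_part \<alpha>) z) \<longrightarrow>
      (\<forall>c\<in>ell_inf. downsample2 ((id - (subdivision \<alpha> \<circ> decimation \<gamma>)) c) = (\<lambda>k. 0)))"
proof (intro conjI allI impI ballI)
  define F where "F = {k. even_part \<alpha> k \<noteq> 0}"
  have F: "finite F"
  proof -
    have "F = (\<lambda>k. 2 * k) -` {k. \<alpha> k \<noteq> 0}" by (auto simp: F_def even_part_def)
    then show ?thesis
      using assms(1) finite_vimageI[of "{k. \<alpha> k \<noteq> 0}" "\<lambda>k. 2 * k"] by (simp add: ell_0_def inj_def)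
  qed
  have sym: "symbol (even_part \<alpha>) z = (\<Sum>k\<in>F. complex_of_real (even_part \<alpha> k) * z powi k)" for z
    unfolding symbol_def
    by (rule infsumI, rule has_sum_finite_neutralI[OF F]) (auto simp: F_def)
  have nz: "symbol (even_part \<alpha>) z \<noteq> 0" if "norm z = 1" for z
    using assms(2) that by (auto simp: unit_circle_def)

  show "\<exists>!\<gamma>. \<gamma> \<in> ell_1 \<and> (\<forall>z\<in>unit_circle. symbol \<gamma> z = 1 / symbol (even_part \<alpha>) z)"
  proof (rule ex_ex1I)
    have "abs_fourier (\<lambda>z. 1 / symbol (even_part \<alpha>) z)"
      using abs_fourier_inverse_laurent_poly[OF F] nz unfolding sym by simp
    from abs_fourier_real_symbol[OF this]
    show "\<exists>\<gamma>. \<gamma> \<in> ell_1 \<and> (\<forall>z\<in>unit_circle. symbol \<gamma> z = 1 / symbol (even_part \<alpha>) z)"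
      by (auto simp: symbol_cnj unit_circle_def)
  next
    fix \<gamma> \<gamma>'
    assume "\<gamma> \<in> ell_1 \<and> (\<forall>z\<in>unit_circle. symbol \<gamma> z = 1 / symbol (even_part \<alpha>) z)"
      "\<gamma>' \<in> ell_1 \<and> (\<forall>z\<in>unit_circle. symbol \<gamma>' z = 1 / symbol (even_part \<alpha>) z)"
    then show "\<gamma> = \<gamma>'" by (intro symbol_unique) (auto simp: unit_circle_def)
  qed

  fix \<gamma> c
  assume \<gamma>: "\<gamma> \<in> ell_1 \<and> (\<forall>z\<in>unit_circle. symbol \<gamma> z = 1 / symbol (even_part \<alpha>) z)"
    and c: "c \<in> ell_inf"
  have d: "downsample2 c \<in> ell_inf"
    unfolding ell_inf_def downsample2_def mem_Collect_eq
    by (rule bounded_subset[of "range c"]) (use c in \<open>auto simp: ell_inf_def\<close>)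
  have supp: "{k. even_part \<alpha> k \<noteq> 0} \<subseteq> F" by (simp add: F_def)
  have "(\<Sum>m\<in>F. even_part \<alpha> m * \<gamma> (j - m)) = (if j = 0 then 1 else 0)" for j
  proof (rule convolution_inverse[OF F supp])
    show "\<gamma> \<in> ell_1" using \<gamma> by blast
    show "symbol \<gamma> z * (\<Sum>k\<in>F. complex_of_real (even_part \<alpha> k) * z powi k) = 1"
      if "norm z = 1" for z
      unfolding sym[symmetric] using \<gamma> nz[OF that] that by (simp add: unit_circle_def)
  qed
  then have "subdivision \<alpha> (decimation \<gamma> c) (2 * k) = downsample2 c k" for k
    unfolding subdivision_even[OF F supp] decimation_def
    using \<gamma> by (intro convolution_inverse_conv F d) auto
  then show "downsample2 ((id - (subdivision \<alpha> \<circ> decimation \<gamma>)) c) = (\<lambda>k. 0)"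
    by (auto simp: downsample2_def fun_eq_iff)
qed

end
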